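(* If $G$ is an almost bipartite non-König-Egerváry graph with the unique odd cycle $C$, then $V(C)\cup N_G[\mathrm{diadem}(G)]=V(G)$.
   Context: All graphs are finite, undirected, loopless, without multiple edges; $n(G)=|V(G)|$. For $A\subseteq V(G)$, $N_G(A)=\{v\in V(G): v \text{ has a neighbor in } A\}$ and $N_G[A]=A\cup N_G(A)$. $\alpha(G)$ is the maximum size of an independent set and $\mu(G)$ the maximum size of a matching. $G$ is a König-Egerváry graph if $\alpha(G)+\mu(G)=n(G)$. $G$ is almost bipartite if it has exactly one odd cycle. For $X\subseteq V(G)$, $d(X)=|X|-|N_G(X)|$; the critical difference is $d(G)=\max\{d(I): I \text{ independent in } G\}$; an independent set $A$ (possibly empty) is a critical independent set if $d(A)=d(G)$. $\mathrm{diadem}(G)$ is the union of all critical independent sets of $G$. *)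

theory Defs
  imports Main
begin

record 'a sgraph =
  verts :: "'a set"
  edges :: "'a set set"

definition simple_graph :: "'a sgraph \<Rightarrow> bool" where
  "simple_graph G \<longleftrightarrow>
     finite (verts G) \<and> (\<forall>e\<in>edges G. e \<subseteq> verts G \<and> card e = 2)"

definition subgraph :: "'a sgraph \<Rightarrow> 'a sgraph \<Rightarrow> bool" where
  "subgraph H G \<longleftrightarrow> simple_graph H \<and> verts H \<subseteq> verts G \<and> edges H \<subseteq> edges G"

definition nbhd :: "'a sgraph \<Rightarrow> 'a set \<Rightarrow> 'a set" where
  "nbhd G A = {v \<in> verts G. \<exists>a\<in>A. {a, v} \<in> edges G}"

definition closed_nbhd :: "'a sgraph \<Rightarrow> 'a set \<Rightarrow> 'a set" where
  "closed_nbhd G A = A \<union> nbhd G A"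

definition independent :: "'a sgraph \<Rightarrow> 'a set \<Rightarrow> bool" where
  "independent G S \<longleftrightarrow> S \<subseteq> verts G \<and> (\<forall>u\<in>S. \<forall>v\<in>S. {u, v} \<notin> edges G)"

definition matching :: "'a sgraph \<Rightarrow> 'a set set \<Rightarrow> bool" where
  "matching G M \<longleftrightarrow> M \<subseteq> edges G \<and> (\<forall>e\<in>M. \<forall>f\<in>M. e \<noteq> f \<longrightarrow> e \<inter> f = {})"

text \<open>For a finite simple graph the sets below, over which the maxima are taken, are finite,
  and they are nonempty because the empty set is independent and a matching.\<close>

definition independence_number :: "'a sgraph \<Rightarrow> nat" where
  "independence_number G = Max {card S | S. independent G S}"

definition matching_number :: "'a sgraph \<Rightarrow> nat" where
  "matching_number G = Max {card M | M. matching G M}"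

definition koenig_egervary :: "'a sgraph \<Rightarrow> bool" where
  "koenig_egervary G \<longleftrightarrow> independence_number G + matching_number G = card (verts G)"

text \<open>A cycle is a graph, not a closed walk: the vertex sequence \<open>vs\<close> is existentially
  quantified, so its rotations and reversals do not count as different cycles.\<close>

definition is_cycle :: "'a sgraph \<Rightarrow> bool" where
  "is_cycle C \<longleftrightarrow>
     (\<exists>vs. distinct vs \<and> 3 \<le> length vs \<and> verts C = set vs \<and>
       edges C = {{vs ! i, vs ! (Suc i mod length vs)} | i. i < length vs})"

definition odd_cycle_of :: "'a sgraph \<Rightarrow> 'a sgraph \<Rightarrow> bool" where
  "odd_cycle_of G C \<longleftrightarrow> subgraph C G \<and> is_cycle C \<and> odd (card (verts C))"

definition almost_bipartite :: "'a sgraph \<Rightarrow> bool" where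
  "almost_bipartite G \<longleftrightarrow> (\<exists>!C. odd_cycle_of G C)"

definition set_difference :: "'a sgraph \<Rightarrow> 'a set \<Rightarrow> int" where
  "set_difference G X = int (card X) - int (card (nbhd G X))"

definition critical_difference :: "'a sgraph \<Rightarrow> int" where
  "critical_difference G = Max {set_difference G I | I. independent G I}"

definition critical_independent :: "'a sgraph \<Rightarrow> 'a set \<Rightarrow> bool" where
  "critical_independent G A \<longleftrightarrow>
     independent G A \<and> set_difference G A = critical_difference G"

definition diadem :: "'a sgraph \<Rightarrow> 'a set" where
  "diadem G = \<Union>{A. critical_independent G A}"

end

theory Submission
  imports Defs
begin

text \<open>
  Choose a critical independent set \<open>A\<close> of maximum cardinality and put \<open>H = G - N[A]\<close>. Adding to
  \<open>A\<close> a nonempty independent set \<open>I\<close> of \<open>H\<close> changes the difference by \<open>|I| - |N\<^sub>H(I)|\<close>, so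
  maximality forces the strict expansion \<open>|I| < |N\<^sub>H(I)|\<close>. As \<open>A\<close> is part of the diadem, it is
  enough to derive a contradiction from a vertex \<open>v\<close> of \<open>H\<close> outside \<open>C\<close>.

  Let \<open>D\<close> be the connected component of \<open>v\<close> in \<open>H - V(C)\<close>. It is attached to at most one vertex
  \<open>c\<close> of \<open>C\<close>: a detour through \<open>D\<close> between two vertices of \<open>C\<close>, closed up by the arc of \<open>C\<close> of
  the right parity, would be a second odd cycle. Moreover \<open>G\<close> becomes bipartite when an edge of
  \<open>C\<close> is removed. Let \<open>X\<close> and \<open>Y\<close> be the vertices of \<open>D\<close> with the colour of \<open>c\<close> and with the
  other colour. Both are independent, \<open>N\<^sub>H(X) \<subseteq> Y\<close> and \<open>N\<^sub>H(Y) \<subseteq> X \<union> {c}\<close>. If \<open>X\<close> is nonempty,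
  expansion gives \<open>|X| < |Y| < |X| + 1\<close>; if \<open>X\<close> is empty, it gives \<open>|Y| < 1\<close> although \<open>v\<close> is in
  \<open>Y\<close>. Both are absurd.

  The parity argument is carried out with colourings instead of walks. If \<open>c\<^sub>1\<close>, \<open>c\<^sub>2\<close> on \<open>C\<close> are
  both attached to \<open>D\<close>, remove from \<open>G\<close> an edge of one arc of \<open>C\<close> between them, or an edge of
  the other arc. The two resulting 2-colourings agree up to a swap on the connected set
  \<open>D \<union> {c\<^sub>1, c\<^sub>2}\<close>, but each is forced along the arc left intact, and the two arcs have lengths of
  different parity.
\<close>

section \<open>Critical independent sets and strict expansion\<close>

lemma finite_independent_sets:
  assumes "simple_graph G"
  shows "finite {I. independent G I}"
proof (rule finite_subset)
  show "{I. independent G I} \<subseteq> Pow (verts G)"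
    by (auto simp: independent_def)
  show "finite (Pow (verts G))"
    using assms by (simp add: simple_graph_def)
qed

lemma set_difference_le_critical_difference:
  assumes "simple_graph G" and "independent G I"
  shows "set_difference G I \<le> critical_difference G"
proof -
  have "finite {set_difference G I | I. independent G I}"
    using finite_independent_sets[OF assms(1)] by simp
  then show ?thesis
    unfolding critical_difference_def using assms(2) by (intro Max_ge) auto
qed

lemma critical_independent_exists:
  assumes "simple_graph G"
  shows "\<exists>A. critical_independent G A"
proof -
  have "finite {set_difference G I | I. independent G I}"
    using finite_independent_sets[OF assms] by simp
  moreover have "independent G {}"
    by (simp add: independent_def)
  ultimately have "critical_difference G \<in> {set_difference G I | I. independent G I}"
    unfolding critical_difference_def by (intro Max_in) auto
  then show ?thesis
    by (auto simp: critical_independent_def)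
qed

text \<open>A critical independent set of maximum cardinality works: an independent set \<open>I\<close> violating
  the inequality could be added to it, and the union would have a larger difference, or the same
  difference and more elements.\<close>

lemma critical_independent_strict_expansion:
  assumes G: "simple_graph G"
  obtains A where "critical_independent G A"
    and "\<And>I. independent G I \<Longrightarrow> I \<noteq> {} \<Longrightarrow> I \<inter> closed_nbhd G A = {} \<Longrightarrow>
      card I < card (nbhd G I - closed_nbhd G A)"
proof -
  have fin: "finite (verts G)"
    using G by (simp add: simple_graph_def)
  have bounded: "\<forall>A. critical_independent G A \<longrightarrow> card A < Suc (card (verts G))"
    using fin by (auto simp: critical_independent_def independent_def less_Suc_eq_le
        intro: card_mono)
  obtain A0 where "critical_independent G A0"
    using critical_independent_exists[OF G] by blast
  then obtain A where A: "critical_independent G A"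
    and A_max: "\<And>B. critical_independent G B \<Longrightarrow> card B \<le> card A"
    using ex_has_greatest_nat[of "critical_independent G" A0 card] bounded by blast
  have A_ind: "independent G A"
    using A by (simp add: critical_independent_def)
  have "card I < card (nbhd G I - closed_nbhd G A)"
    if I: "independent G I" "I \<noteq> {}" "I \<inter> closed_nbhd G A = {}" for I
  proof (rule ccontr)
    assume not_less: "\<not> card I < card (nbhd G I - closed_nbhd G A)"
    have finA: "finite A" and finI: "finite I"
      using A_ind I(1) fin finite_subset by (auto simp: independent_def)
    have finN: "finite (nbhd G B)" for B
      using fin by (simp add: nbhd_def)
    have no_edge: "{a, i} \<notin> edges G" "{i, a} \<notin> edges G" if "a \<in> A" "i \<in> I" for a i
      using that I(1,3) unfolding closed_nbhd_def nbhd_def independent_def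
      by (fastforce simp: insert_commute)+
    have union_ind: "independent G (A \<union> I)"
      using A_ind I(1) no_edge by (auto simp: independent_def)
    have "nbhd G (A \<union> I) = nbhd G A \<union> (nbhd G I - closed_nbhd G A)"
      using no_edge by (auto simp: nbhd_def closed_nbhd_def)
    then have "card (nbhd G (A \<union> I)) = card (nbhd G A) + card (nbhd G I - closed_nbhd G A)"
      using finN by (subst card_Un_disjoint[symmetric]) (auto simp: closed_nbhd_def)
    moreover have card_union: "card (A \<union> I) = card A + card I"
      using I(3) finA finI by (intro card_Un_disjoint) (auto simp: closed_nbhd_def)
    ultimately have "set_difference G A \<le> set_difference G (A \<union> I)"
      using not_less by (simp add: set_difference_def)
    then have "critical_independent G (A \<union> I)"
      using A union_ind set_difference_le_critical_difference[OF G union_ind]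
      by (simp add: critical_independent_def)
    then have "card (A \<union> I) \<le> card A"
      by (rule A_max)
    then show False
      using card_union I(2) finI by auto
  qed
  with A show ?thesis
    by (rule that)
qed

section \<open>Graphs without odd cycles are bipartite\<close>

definition proper_colouring :: "'a set set \<Rightarrow> ('a \<Rightarrow> bool) \<Rightarrow> bool" where
  "proper_colouring F f \<longleftrightarrow> (\<forall>u v. {u, v} \<in> F \<longrightarrow> f u \<noteq> f v)"

lemma proper_colouring_mono: "proper_colouring F f \<Longrightarrow> E \<subseteq> F \<Longrightarrow> proper_colouring E f"
  by (auto simp: proper_colouring_def)

lemma alternating_parity:
  fixes g :: "nat \<Rightarrow> bool"
  assumes "i \<le> j" and "\<And>k. i \<le> k \<Longrightarrow> k < j \<Longrightarrow> g k \<noteq> g (Suc k)"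
  shows "g i = g j \<longleftrightarrow> even (i + j)"
  using assms
proof (induction j rule: dec_induct)
  case (step n)
  then have "g i = g n \<longleftrightarrow> even (i + n)" and "g n \<noteq> g (Suc n)"
    by auto
  then show ?case
    by auto
qed auto

lemma simple_path_exists:
  assumes "(a, b) \<in> {(x, y). {x, y} \<in> F}\<^sup>*"
  shows "\<exists>p. p \<noteq> [] \<and> distinct p \<and> p ! 0 = a \<and> p ! (length p - 1) = b \<and>
    (\<forall>k. Suc k < length p \<longrightarrow> {p ! k, p ! Suc k} \<in> F)"
  using assms
proof (induction rule: rtrancl_induct)
  case base
  show ?case
    by (rule exI[of _ "[a]"]) simp
next
  case (step y z)
  then obtain p where p: "p \<noteq> []" "distinct p" "p ! 0 = a" "p ! (length p - 1) = y"
    "\<forall>k. Suc k < length p \<longrightarrow> {p ! k, p ! Suc k} \<in> F"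
    by blast
  show ?case
  proof (cases "z \<in> set p")
    \<comment> \<open>If the path already visits the new end \<open>z\<close>, it is cut off there.\<close>
    case True
    then obtain m where m: "m < length p" "p ! m = z"
      by (auto simp: in_set_conv_nth)
    show ?thesis
      by (rule exI[of _ "take (Suc m) p"]) (use p m in auto)
  next
    case False
    have "{(p @ [z]) ! k, (p @ [z]) ! Suc k} \<in> F" if "Suc k < length (p @ [z])" for k
    proof (cases "Suc k < length p")
      case True
      then show ?thesis
        using p(5) by (simp add: nth_append)
    next
      case False
      with that have "k = length p - 1"
        by simp
      then show ?thesis
        using p(1,4) step.hyps(2) by (simp add: nth_append)
    qed
    then show ?thesis
      using p(1-4) False by (intro exI[of _ "p @ [z]"]) (simp add: nth_append)
  qed
qed

lemma odd_closed_path_is_odd_cycle: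
  assumes F: "\<And>e. e \<in> edges G \<Longrightarrow> e \<subseteq> verts G \<and> card e = 2"
    and p: "distinct p" "3 \<le> length p" "odd (length p)"
    and steps: "\<forall>k. Suc k < length p \<longrightarrow> {p ! k, p ! Suc k} \<in> edges G"
    and closing: "{p ! (length p - 1), p ! 0} \<in> edges G"
  shows "\<exists>C. odd_cycle_of G C"
proof -
  define n where "n = length p"
  define E where "E = {{p ! i, p ! (Suc i mod n)} | i. i < n}"
  have E_sub: "E \<subseteq> edges G"
  proof
    fix x assume "x \<in> E"
    then obtain i where i: "i < n" "x = {p ! i, p ! (Suc i mod n)}"
      by (auto simp: E_def)
    show "x \<in> edges G"
    proof (cases "Suc i < n")
      case True
      then show ?thesis
        using i steps by (simp add: n_def)
    next
      case False
      with i(1) have "Suc i = n"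
        by simp
      then have "i = n - 1" "Suc i mod n = 0"
        by auto
      then show ?thesis
        using i closing by (simp add: n_def)
    qed
  qed
  have "Suc i mod n < n" for i
    using p(2) unfolding n_def by (intro mod_less_divisor) linarith
  then have E_in: "x \<subseteq> set p" if "x \<in> E" for x
    using that by (auto simp: E_def n_def)
  have "set p \<subseteq> verts G"
  proof
    fix x assume "x \<in> set p"
    then obtain i where i: "i < n" "x = p ! i"
      by (auto simp: in_set_conv_nth n_def)
    then have "{p ! i, p ! (Suc i mod n)} \<in> E"
      by (auto simp: E_def)
    then show "x \<in> verts G"
      using F E_sub i by blast
  qed
  moreover have "is_cycle \<lparr>verts = set p, edges = E\<rparr>"
    unfolding is_cycle_def using p by (intro exI[of _ p]) (simp add: E_def n_def)
  moreover have "odd (card (set p))"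
    using p by (simp add: distinct_card)
  moreover have "simple_graph \<lparr>verts = set p, edges = E\<rparr>"
    using F E_sub E_in by (auto simp: simple_graph_def)
  ultimately have "odd_cycle_of G \<lparr>verts = set p, edges = E\<rparr>"
    using E_sub by (simp add: odd_cycle_of_def subgraph_def)
  then show ?thesis
    by blast
qed

lemma odd_cycle_of_mono:
  assumes "odd_cycle_of H C" and "verts H \<subseteq> verts G" and "edges H \<subseteq> edges G"
  shows "odd_cycle_of G C"
  using assms by (auto simp: odd_cycle_of_def subgraph_def)

text \<open>Edges are added one at a time. If the new edge \<open>ab\<close> joins two components of the old graph,
  swapping the colours on one of them repairs the colouring. Otherwise a path from \<open>a\<close> to \<open>b\<close>
  between vertices of equal colour has an odd number of vertices, and \<open>ab\<close> closes it to an odd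
  cycle.\<close>

lemma no_odd_cycle_imp_proper_colouring:
  assumes "simple_graph G" and "\<nexists>C. odd_cycle_of G C"
  shows "\<exists>f. proper_colouring (edges G) f"
proof -
  have colour: "\<exists>f. proper_colouring F f"
    if "finite F" "\<And>e. e \<in> F \<Longrightarrow> e \<subseteq> V \<and> card e = 2"
      "\<nexists>C. odd_cycle_of \<lparr>verts = V, edges = F\<rparr> C" for F and V :: "'a set"
    using that
  proof (induction F rule: finite_induct)
    case empty
    show ?case
      by (simp add: proper_colouring_def)
  next
    case (insert e F)
    let ?G = "\<lparr>verts = V, edges = insert e F\<rparr>"
    have no_cycle: "\<nexists>C. odd_cycle_of \<lparr>verts = V, edges = F\<rparr> C"
      using insert.prems(2) odd_cycle_of_mono[of "\<lparr>verts = V, edges = F\<rparr>" _ ?G] by auto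
    obtain f where "proper_colouring F f"
      using insert.IH[OF _ no_cycle] insert.prems(1) by auto
    then have f: "f u \<noteq> f v" if "{u, v} \<in> F" for u v
      using that by (simp add: proper_colouring_def)
    obtain a b where e: "e = {a, b}" "a \<noteq> b"
      using insert.prems(1)[of e] by (auto simp: card_2_iff)
    show ?case
    proof (cases "f a = f b")
      case False
      then have "proper_colouring (insert e F) f"
        using f unfolding e(1) proper_colouring_def by (auto simp: doubleton_eq_iff)
      then show ?thesis
        by (rule exI[of _ f])
    next
      case True
      define R where "R = {(x, y). {x, y} \<in> F}"
      have "(a, b) \<notin> R\<^sup>*"
      proof
        assume "(a, b) \<in> R\<^sup>*"
        then obtain p where p: "p \<noteq> []" "distinct p" "p ! 0 = a" "p ! (length p - 1) = b"
          "\<forall>k. Suc k < length p \<longrightarrow> {p ! k, p ! Suc k} \<in> F"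
          using simple_path_exists[of a b F] unfolding R_def by blast
        have "f (p ! 0) = f (p ! (length p - 1)) \<longleftrightarrow> even (0 + (length p - 1))"
          using p(5) f by (intro alternating_parity[where g = "\<lambda>k. f (p ! k)"]) simp_all
        then have "even (length p - 1)"
          using p(3,4) True by simp
        with p(1) have odd: "odd (length p)"
          by (cases p) auto
        moreover have "length p \<noteq> 1"
          using p(3,4) e(2) by auto
        ultimately have "3 \<le> length p"
          by presburger
        moreover have "{p ! (length p - 1), p ! 0} \<in> edges ?G"
          using p(3,4) e(1) by (simp add: insert_commute)
        ultimately have "\<exists>C. odd_cycle_of ?G C"
          using p(2,5) odd insert.prems(1) by (intro odd_closed_path_is_odd_cycle[of _ p]) simp_all
        then show False
          using insert.prems(2) by blast
      qed
      \<comment> \<open>Swap the colours on the component of \<open>a\<close>, which does not contain \<open>b\<close>.\<close>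
      define g where "g x = (f x \<noteq> ((a, x) \<in> R\<^sup>*))" for x
      have "(a, u) \<in> R\<^sup>* \<longleftrightarrow> (a, v) \<in> R\<^sup>*" if "{u, v} \<in> F" for u v
      proof -
        have "(u, v) \<in> R" "(v, u) \<in> R"
          using that by (auto simp: R_def insert_commute)
        then show ?thesis
          by (blast intro: rtrancl_into_rtrancl)
      qed
      then have "g u \<noteq> g v" if "{u, v} \<in> F" for u v
        using f[OF that] that by (simp add: g_def)
      moreover have "g a \<noteq> g b"
        using True \<open>(a, b) \<notin> R\<^sup>*\<close> by (simp add: g_def)
      ultimately have "proper_colouring (insert e F) g"
        unfolding e(1) proper_colouring_def by (auto simp: doubleton_eq_iff)
      then show ?thesis
        by (rule exI[of _ g])
    qed
  qed
  have "edges G \<subseteq> Pow (verts G)"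
    using assms(1) by (auto simp: simple_graph_def)
  then have "finite (edges G)"
    using assms(1) by (meson finite_Pow_iff finite_subset simple_graph_def)
  then show ?thesis
    using assms odd_cycle_of_mono[of "\<lparr>verts = verts G, edges = edges G\<rparr>" _ G]
    by (intro colour[of _ "verts G"]) (auto simp: simple_graph_def)
qed

section \<open>The unique odd cycle\<close>

lemma unique_odd_cycle_edge_removal:
  assumes "simple_graph G" and "almost_bipartite G" and "odd_cycle_of G C" and "e \<in> edges C"
  shows "\<exists>f. proper_colouring (edges G - {e}) f"
proof -
  let ?H = "\<lparr>verts = verts G, edges = edges G - {e}\<rparr>"
  have "\<not> odd_cycle_of ?H B" for B
  proof
    assume B: "odd_cycle_of ?H B"
    then have "odd_cycle_of G B"
      by (rule odd_cycle_of_mono) auto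
    then have "B = C"
      using assms(2,3) by (auto simp: almost_bipartite_def)
    then show False
      using B assms(4) by (auto simp: odd_cycle_of_def subgraph_def)
  qed
  moreover have "simple_graph ?H"
    using assms(1) by (auto simp: simple_graph_def)
  ultimately show ?thesis
    using no_odd_cycle_imp_proper_colouring[of ?H] by auto
qed

text \<open>The edges to be removed are the closing edge of the cycle and the first edge after \<open>c\<^sub>1\<close>,
  where \<open>c\<^sub>1\<close> precedes \<open>c\<^sub>2\<close> in the vertex sequence. They lie on different arcs between \<open>c\<^sub>1\<close> and
  \<open>c\<^sub>2\<close>, and since the arcs have lengths of different parity, the two colourings disagree on
  whether \<open>c\<^sub>1\<close> and \<open>c\<^sub>2\<close> have the same colour.\<close>

lemma odd_cycle_separating_edges:
  assumes "is_cycle C" and "odd (card (verts C))"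
    and "c1 \<in> verts C" and "c2 \<in> verts C" and "c1 \<noteq> c2"
  obtains e1 e2 where "e1 \<in> edges C" and "e2 \<in> edges C"
    and "\<And>f1 f2. proper_colouring (edges C - {e1}) f1 \<Longrightarrow> proper_colouring (edges C - {e2}) f2 \<Longrightarrow>
      (f1 c1 = f1 c2) \<noteq> (f2 c1 = f2 c2)"
proof -
  obtain vs where vs: "distinct vs" "3 \<le> length vs" "verts C = set vs"
    "edges C = {{vs ! i, vs ! (Suc i mod length vs)} | i. i < length vs}"
    using assms(1) by (auto simp: is_cycle_def)
  define n where "n = length vs"
  have n: "3 \<le> n" "odd n"
    using vs assms(2) by (auto simp: n_def distinct_card)
  define E where "E k = {vs ! k, vs ! (Suc k mod n)}" for k
  have edge: "E k \<in> edges C" if "k < n" for k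
    using that vs(4) by (auto simp: E_def n_def)
  \<comment> \<open>This needs \<open>n \<ge> 3\<close>: with two vertices, both directions give the same edge.\<close>
  have E_inj: "E k \<noteq> E l" if "k < n" "l < n" "k \<noteq> l" for k l
  proof
    have "Suc k mod n < n" "Suc l mod n < n"
      using n(1) by (intro mod_less_divisor; simp)+
    moreover assume "E k = E l"
    ultimately have "k = Suc l mod n" "l = Suc k mod n"
      using that vs(1) by (auto simp: E_def doubleton_eq_iff nth_eq_iff_index_eq n_def)
    then show False
      using that n(1) by (simp only: mod_Suc mod_less split: if_splits)
  qed
  have step: "f (vs ! k) \<noteq> f (vs ! Suc k)"
    if "proper_colouring (edges C - {E m}) f" "m < n" "Suc k < n" "k \<noteq> m" for f m k
  proof -
    have "E k \<in> edges C - {E m}"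
      using edge E_inj that by auto
    then show ?thesis
      using that by (auto simp: proper_colouring_def E_def)
  qed
  have differ: "(f1 (vs ! i) = f1 (vs ! j)) \<noteq> (f2 (vs ! i) = f2 (vs ! j))"
    if ij: "i < j" "j < n"
      and f1: "proper_colouring (edges C - {E i}) f1"
      and f2: "proper_colouring (edges C - {E (n - 1)}) f2" for i j f1 f2
  proof -
    have "f2 (vs ! i) = f2 (vs ! j) \<longleftrightarrow> even (i + j)"
      using ij by (intro alternating_parity[where g = "\<lambda>k. f2 (vs ! k)"] step[OF f2]) simp_all
    moreover have "f1 (vs ! 0) = f1 (vs ! i) \<longleftrightarrow> even (0 + i)"
      using ij by (intro alternating_parity[where g = "\<lambda>k. f1 (vs ! k)"] step[OF f1]) simp_all
    moreover have "f1 (vs ! j) = f1 (vs ! (n - 1)) \<longleftrightarrow> even (j + (n - 1))"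
      using ij by (intro alternating_parity[where g = "\<lambda>k. f1 (vs ! k)"] step[OF f1]) simp_all
    moreover have "f1 (vs ! (n - 1)) \<noteq> f1 (vs ! 0)"
    proof -
      have "E (n - 1) \<in> edges C - {E i}"
        using edge E_inj[of "n - 1" i] ij by auto
      moreover have "E (n - 1) = {vs ! (n - 1), vs ! 0}"
        using n by (simp add: E_def)
      ultimately show ?thesis
        using f1 by (simp add: proper_colouring_def)
    qed
    moreover have "even (n - 1)"
      using n by simp
    ultimately show ?thesis
      unfolding even_add add_0 by satx
  qed
  obtain i j where ij: "i < n" "j < n" "c1 = vs ! i" "c2 = vs ! j"
    using assms(3,4) vs(3) by (auto simp: in_set_conv_nth n_def)
  then consider "i < j" | "j < i"
    using assms(5) by (metis linorder_neqE_nat)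
  then show ?thesis
  proof cases
    case 1
    show ?thesis
    proof (rule that)
      show "E i \<in> edges C" "E (n - 1) \<in> edges C"
        using edge ij(1) n(1) by auto
    qed (use differ[OF 1 ij(2)] ij(3,4) in simp)
  next
    case 2
    show ?thesis
    proof (rule that)
      show "E j \<in> edges C" "E (n - 1) \<in> edges C"
        using edge ij(2) n(1) by auto
      fix f1 f2
      assume "proper_colouring (edges C - {E j}) f1" "proper_colouring (edges C - {E (n - 1)}) f2"
      then have "(f1 c2 = f1 c1) \<noteq> (f2 c2 = f2 c1)"
        unfolding ij(3,4) by (rule differ[OF 2 ij(1)])
      then show "(f1 c1 = f1 c2) \<noteq> (f2 c1 = f2 c2)"
        by argo
    qed
  qed
qed

text \<open>Only the end of a step is required to lie in \<open>W\<close>. The result is the component of \<open>v\<close> in the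
  subgraph induced by \<open>W\<close> when \<open>v \<in> W\<close>, which is the case of interest.\<close>

definition component_within :: "'a sgraph \<Rightarrow> 'a set \<Rightarrow> 'a \<Rightarrow> 'a set" where
  "component_within G W v = {(x, y). {x, y} \<in> edges G \<and> y \<in> W}\<^sup>* `` {v}"

lemma component_within_subset: "v \<in> W \<Longrightarrow> component_within G W v \<subseteq> W"
  by (auto simp: component_within_def elim: rtranclE)

lemma component_within_self: "v \<in> component_within G W v"
  by (simp add: component_within_def)

lemma component_within_closed:
  "x \<in> component_within G W v \<Longrightarrow> {x, y} \<in> edges G \<Longrightarrow> y \<in> W \<Longrightarrow> y \<in> component_within G W v"
  by (auto simp: component_within_def intro: rtrancl_into_rtrancl)

text \<open>Along an edge into \<open>W\<close> both colourings change, so whether they agree at a vertex is the same at both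
  ends of it.\<close>

lemma proper_colourings_agree_on_component:
  fixes f g :: "'a \<Rightarrow> bool"
  assumes "\<And>x y. {x, y} \<in> edges G \<Longrightarrow> y \<in> W \<Longrightarrow> f x \<noteq> f y \<and> g x \<noteq> g y"
    and "x \<in> component_within G W v"
  shows "f x = g x \<longleftrightarrow> f v = g v"
proof -
  have "(v, x) \<in> {(x, y). {x, y} \<in> edges G \<and> y \<in> W}\<^sup>*"
    using assms(2) by (simp add: component_within_def)
  then show ?thesis
    by (induction rule: rtrancl_induct) (use assms(1) in auto)
qed

text \<open>A component off the cycle attached at two vertices would fix whether these have equal
  colours, whichever edge of \<open>C\<close> is removed before colouring; the two separating edges of the
  cycle give opposite answers.\<close>

lemma component_attached_to_at_most_one_cycle_vertex:
  assumes G: "simple_graph G" "almost_bipartite G" and C: "odd_cycle_of G C"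
    and W: "W \<inter> verts C = {}" "v \<in> W"
    and att: "d1 \<in> component_within G W v" "{d1, c1} \<in> edges G" "c1 \<in> verts C"
      "d2 \<in> component_within G W v" "{d2, c2} \<in> edges G" "c2 \<in> verts C"
  shows "c1 = c2"
proof (rule ccontr)
  assume "c1 \<noteq> c2"
  moreover have "is_cycle C" "odd (card (verts C))" and C_sub: "edges C \<subseteq> edges G"
    and C_edges: "\<And>e. e \<in> edges C \<Longrightarrow> e \<subseteq> verts C"
    using C by (auto simp: odd_cycle_of_def subgraph_def simple_graph_def)
  ultimately obtain e1 e2 where e: "e1 \<in> edges C" "e2 \<in> edges C"
    and differ: "\<And>f1 f2. proper_colouring (edges C - {e1}) f1 \<Longrightarrow>
      proper_colouring (edges C - {e2}) f2 \<Longrightarrow> (f1 c1 = f1 c2) \<noteq> (f2 c1 = f2 c2)"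
    using odd_cycle_separating_edges[of C c1 c2] att(3,6) by blast
  obtain f1 f2 where f: "proper_colouring (edges G - {e1}) f1"
    "proper_colouring (edges G - {e2}) f2"
    using unique_odd_cycle_edge_removal[OF G C] e by blast
  then have "(f1 c1 = f1 c2) \<noteq> (f2 c1 = f2 c2)"
    using C_sub by (intro differ) (blast intro: proper_colouring_mono)+
  moreover have off_cycle: "f1 x \<noteq> f1 y \<and> f2 x \<noteq> f2 y" if "{x, y} \<in> edges G" "x \<in> W \<or> y \<in> W" for x y
  proof -
    have "{x, y} \<notin> edges C"
      using C_edges that(2) W(1) by blast
    then have "{x, y} \<in> edges G - {e1}" "{x, y} \<in> edges G - {e2}"
      using e that(1) by auto
    then show ?thesis
      using f unfolding proper_colouring_def by blast
  qed
  moreover have "d1 \<in> W" "d2 \<in> W"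
    using att(1,4) component_within_subset[OF W(2), of G] by auto
  then have "f1 d1 \<noteq> f1 c1" "f2 d1 \<noteq> f2 c1" "f1 d2 \<noteq> f1 c2" "f2 d2 \<noteq> f2 c2"
    using off_cycle[OF att(2)] off_cycle[OF att(5)] by simp_all
  moreover have "f1 d1 = f2 d1 \<longleftrightarrow> f1 v = f2 v" "f1 d2 = f2 d2 \<longleftrightarrow> f1 v = f2 v"
    using proper_colourings_agree_on_component[of G W f1 f2, OF off_cycle] att(1,4) by simp_all
  ultimately show False
    by argo
qed

section \<open>The vertices outside the cycle\<close>

theorem theorem2p11:
  fixes G C :: "'a sgraph"
  assumes "simple_graph G"
    and "almost_bipartite G"
    and "\<not> koenig_egervary G"
    and "odd_cycle_of G C"
  shows "verts C \<union> closed_nbhd G (diadem G) = verts G"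
proof
  have "verts C \<subseteq> verts G"
    using assms(4) by (simp add: odd_cycle_of_def subgraph_def)
  moreover have "diadem G \<subseteq> verts G"
    by (auto simp: diadem_def critical_independent_def independent_def)
  ultimately show "verts C \<union> closed_nbhd G (diadem G) \<subseteq> verts G"
    by (auto simp: closed_nbhd_def nbhd_def)
next
  have fin: "finite (verts G)"
    and edges_in: "\<And>x y. {x, y} \<in> edges G \<Longrightarrow> x \<in> verts G \<and> y \<in> verts G"
    using assms(1) by (auto simp: simple_graph_def)
  obtain A where A: "critical_independent G A"
    and expansion: "\<And>I. independent G I \<Longrightarrow> I \<noteq> {} \<Longrightarrow> I \<inter> closed_nbhd G A = {} \<Longrightarrow>
      card I < card (nbhd G I - closed_nbhd G A)"
    using critical_independent_strict_expansion[OF assms(1)] by blast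
  have "A \<subseteq> diadem G"
    using A by (auto simp: diadem_def)
  then have "closed_nbhd G A \<subseteq> closed_nbhd G (diadem G)"
    by (auto simp: closed_nbhd_def nbhd_def)
  moreover have "v \<in> verts C \<union> closed_nbhd G A" if "v \<in> verts G" for v
  proof (rule ccontr)
    assume v: "v \<notin> verts C \<union> closed_nbhd G A"
    define W where "W = verts G - verts C - closed_nbhd G A"
    have W: "W \<inter> verts C = {}" "v \<in> W"
      using v that by (auto simp: W_def)
    define D where "D = component_within G W v"
    have D: "D \<subseteq> W" "v \<in> D"
      using component_within_subset[OF W(2)] component_within_self by (auto simp: D_def)
    \<comment> \<open>If no vertex of \<open>C\<close> is attached to \<open>D\<close>, any \<open>c\<close> will do.\<close>
    obtain c where c: "\<And>d x. d \<in> D \<Longrightarrow> {d, x} \<in> edges G \<Longrightarrow> x \<in> verts C \<Longrightarrow> x = c"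
    proof (cases "\<exists>d\<in>D. \<exists>c\<in>verts C. {d, c} \<in> edges G")
      case True
      then obtain d c where "d \<in> D" "c \<in> verts C" "{d, c} \<in> edges G"
        by blast
      then show ?thesis
        using component_attached_to_at_most_one_cycle_vertex[OF assms(1,2,4) W]
        by (intro that[of c]) (simp add: D_def)
    next
      case False
      then show ?thesis
        using that by blast
    qed
    obtain e where e: "e \<in> edges C"
      using assms(4) by (fastforce simp: odd_cycle_of_def is_cycle_def)
    then have e_sub: "e \<subseteq> verts C"
      using assms(4) by (auto simp: odd_cycle_of_def subgraph_def simple_graph_def)
    obtain f where f: "proper_colouring (edges G - {e}) f"
      using unique_odd_cycle_edge_removal[OF assms(1,2,4) e] by blast
    have f_D: "f x \<noteq> f y" if "{x, y} \<in> edges G" "x \<in> D" for x y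
    proof -
      have "{x, y} \<noteq> e"
        using that(2) D(1) W(1) e_sub by blast
      then show ?thesis
        using f that(1) by (simp add: proper_colouring_def)
    qed
    define X where "X = {x \<in> D. f x = f c}"
    define Y where "Y = {x \<in> D. f x \<noteq> f c}"
    have D_sub: "D \<subseteq> verts G" "D \<inter> closed_nbhd G A = {}"
      using D(1) by (auto simp: W_def)
    have finXY: "finite X" "finite Y"
      using finite_subset[OF D_sub(1) fin] by (auto simp: X_def Y_def)
    have ind: "independent G X" "independent G Y"
      using f_D D_sub(1) by (auto simp: independent_def X_def Y_def)
    have step: "y = c \<or> y \<in> D" if "{x, y} \<in> edges G" "x \<in> D" "y \<notin> closed_nbhd G A" for x y
    proof (cases "y \<in> verts C")
      case True
      then show ?thesis
        using c that by blast
    next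
      case False
      then have "y \<in> W"
        using that edges_in by (auto simp: W_def)
      then show ?thesis
        using that component_within_closed[of x G W v y] by (simp add: D_def)
    qed
    have disj: "X \<inter> closed_nbhd G A = {}" "Y \<inter> closed_nbhd G A = {}"
      using D_sub(2) by (auto simp: X_def Y_def)
    have "nbhd G X - closed_nbhd G A \<subseteq> Y"
    proof
      fix y assume "y \<in> nbhd G X - closed_nbhd G A"
      then obtain x where x: "x \<in> D" "f x = f c" "{x, y} \<in> edges G" "y \<notin> closed_nbhd G A"
        by (auto simp: nbhd_def X_def)
      then show "y \<in> Y"
        using step[OF x(3,1,4)] f_D[OF x(3,1)] by (auto simp: Y_def)
    qed
    then have X_less: "card X < card Y" if "X \<noteq> {}"
      using expansion[OF ind(1) that disj(1)] card_mono[OF finXY(2)] by (meson less_le_trans)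
    have "nbhd G Y - closed_nbhd G A \<subseteq> insert c X"
    proof
      fix y assume "y \<in> nbhd G Y - closed_nbhd G A"
      then obtain x where x: "x \<in> D" "f x \<noteq> f c" "{x, y} \<in> edges G" "y \<notin> closed_nbhd G A"
        by (auto simp: nbhd_def Y_def)
      then show "y \<in> insert c X"
        using step[OF x(3,1,4)] f_D[OF x(3,1)] by (auto simp: X_def)
    qed
    then have "card (nbhd G Y - closed_nbhd G A) \<le> card (insert c X)"
      using finXY by (intro card_mono) auto
    also have "\<dots> \<le> Suc (card X)"
      using finXY(1) by (simp add: card_insert_if)
    finally have Y_le: "card Y \<le> card X" if "Y \<noteq> {}"
      using expansion[OF ind(2) that disj(2)] by simp
    have "X \<noteq> {} \<or> Y \<noteq> {}"
      using D(2) by (auto simp: X_def Y_def)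
    moreover have "Y \<noteq> {}" if "X \<noteq> {}"
      using X_less[OF that] by auto
    moreover have "X \<noteq> {}" if "Y \<noteq> {}"
      using Y_le[OF that] that finXY(2) by (auto simp: card_gt_0_iff)
    ultimately show False
      using X_less Y_le by fastforce
  qed
  ultimately show "verts G \<subseteq> verts C \<union> closed_nbhd G (diadem G)"
    by blast
qed

end
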